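(* Let $q\ge 2$, $n\ge1$, let $\mathcal A$ be a set of size $q$, and let $f:\mathcal A^n\to\{0,-1,1\}$ be an arbitrary function. Then $f$ is a $\lambda_1(n,q)$-eigenfunction of $H(n,q)$, where $\lambda_1(n,q)=(q-1)n-q$, if and only if $f$ is an $(A,B,i,j)$-cross (for some $A,B,i,j$), or an $(A,B,i)$-string (for some $A,B,i$), or the all-zero function.
   Context: The Hamming graph $H(n,q)$ has vertex set $\mathcal A^n$, $|\mathcal A|=q$, two tuples being adjacent iff they differ in exactly one coordinate. A function $f$ on the vertices of a graph is a $\lambda$-eigenfunction if its vector of values is either the all-zero vector or an eigenvector of the adjacency matrix with eigenvalue $\lambda$. For $i\in\{1,\dots,n\}$ and $A,B\subset\mathcal A$ with $A\cap B=\varnothing$, $A\cup B\ne\varnothing$ and $|A|=|B|$, the $(A,B,i)$-string is the function on $\mathcal A^n$ with value $1$ at $x$ if $x_i\in A$, value $-1$ if $x_i\in B$, and $0$ otherwise. For distinct $i,j\in\{1,\dots,n\}$ and nonempty subsets $A,B\subseteq\mathcal A$ with $|A|=|B|$, the $(A,B,i,j)$-cross is the function on $\mathcal A^n$ with value $1$ at $x$ if $x_i\in A$ and $x_j\notin B$, value $-1$ if $x_i\notin A$ and $x_j\in B$, and $0$ otherwise. *)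

theory Defs
  imports Complex_Main "HOL-Library.FuncSet"
begin

text \<open>
  Tuples are extensional functions on the index set \<open>{1..n}\<close>; a graph is given by its vertex set
  and its adjacency relation, and a matrix indexed by the vertices is a function of two vertices.
\<close>

definition hamming_verts :: "nat \<Rightarrow> 'a set \<Rightarrow> (nat \<Rightarrow> 'a) set" where
  "hamming_verts n S = {1..n} \<rightarrow>\<^sub>E S"

definition hamming_adj :: "nat \<Rightarrow> (nat \<Rightarrow> 'a) \<Rightarrow> (nat \<Rightarrow> 'a) \<Rightarrow> bool" where
  "hamming_adj n x y \<longleftrightarrow> card {i \<in> {1..n}. x i \<noteq> y i} = 1"

definition adjacency_matrix :: "('v \<Rightarrow> 'v \<Rightarrow> bool) \<Rightarrow> 'v \<Rightarrow> 'v \<Rightarrow> real" where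
  "adjacency_matrix adj x y = (if adj x y then 1 else 0)"

definition is_eigenvector ::
    "'v set \<Rightarrow> ('v \<Rightarrow> 'v \<Rightarrow> real) \<Rightarrow> real \<Rightarrow> ('v \<Rightarrow> real) \<Rightarrow> bool" where
  "is_eigenvector V M l v \<longleftrightarrow>
     (\<exists>x\<in>V. v x \<noteq> 0) \<and> (\<forall>x\<in>V. (\<Sum>y\<in>V. M x y * v y) = l * v x)"

definition is_eigenfunction ::
    "'v set \<Rightarrow> ('v \<Rightarrow> 'v \<Rightarrow> bool) \<Rightarrow> real \<Rightarrow> ('v \<Rightarrow> real) \<Rightarrow> bool" where
  "is_eigenfunction V adj l f \<longleftrightarrow>
     (\<forall>x\<in>V. f x = 0) \<or> is_eigenvector V (adjacency_matrix adj) l f"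

definition hamming_eigenvalue1 :: "nat \<Rightarrow> nat \<Rightarrow> real" where
  "hamming_eigenvalue1 n q = (real q - 1) * real n - real q"

definition string_fun :: "'a set \<Rightarrow> 'a set \<Rightarrow> nat \<Rightarrow> (nat \<Rightarrow> 'a) \<Rightarrow> real" where
  "string_fun A B i x = (if x i \<in> A then 1 else if x i \<in> B then -1 else 0)"

definition cross_fun :: "'a set \<Rightarrow> 'a set \<Rightarrow> nat \<Rightarrow> nat \<Rightarrow> (nat \<Rightarrow> 'a) \<Rightarrow> real" where
  "cross_fun A B i j x =
     (if x i \<in> A \<and> x j \<notin> B then 1 else if x i \<notin> A \<and> x j \<in> B then -1 else 0)"

text \<open>
  A function on the vertices is identified with its restriction to the vertex set, so the
  predicates below ask for agreement there only.
\<close>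

definition is_string :: "nat \<Rightarrow> 'a set \<Rightarrow> ((nat \<Rightarrow> 'a) \<Rightarrow> real) \<Rightarrow> bool" where
  "is_string n S f \<longleftrightarrow>
     (\<exists>A B i. i \<in> {1..n} \<and> A \<subseteq> S \<and> B \<subseteq> S \<and> A \<inter> B = {} \<and> A \<union> B \<noteq> {} \<and> card A = card B \<and>
        (\<forall>x\<in>hamming_verts n S. f x = string_fun A B i x))"

definition is_cross :: "nat \<Rightarrow> 'a set \<Rightarrow> ((nat \<Rightarrow> 'a) \<Rightarrow> real) \<Rightarrow> bool" where
  "is_cross n S f \<longleftrightarrow>
     (\<exists>A B i j. i \<in> {1..n} \<and> j \<in> {1..n} \<and> i \<noteq> j \<and>
        A \<subseteq> S \<and> B \<subseteq> S \<and> A \<noteq> {} \<and> B \<noteq> {} \<and> card A = card B \<and>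
        (\<forall>x\<in>hamming_verts n S. f x = cross_fun A B i j x))"

end

theory Submission
  imports Defs
begin

text \<open>
  Let \<open>D\<^sub>i\<close> be the identity minus averaging over the \<open>i\<close>-th coordinate. The \<open>D\<^sub>i\<close> are commuting
  orthogonal projections, and the eigenvalue equation says \<open>(\<Sum>\<^sub>i D\<^sub>i) f = f\<close>. Applying \<open>D\<^sub>i\<close> gives
  \<open>(\<Sum>\<^sub>j\<^sub>\<noteq>\<^sub>i D\<^sub>j D\<^sub>i) f = 0\<close>, whose inner product with \<open>f\<close> is the sum of the squared norms of the
  \<open>D\<^sub>j D\<^sub>i f\<close>; hence \<open>D\<^sub>i f\<close> depends on the \<open>i\<close>-th coordinate only and \<open>f x = (\<Sum>\<^sub>i g\<^sub>i (x\<^sub>i))\<close> with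
  every \<open>g\<^sub>i\<close> of sum zero. If \<open>f\<close> takes values in \<open>{0, -1, 1}\<close>, the oscillations of the \<open>g\<^sub>i\<close> are
  integers with sum at most \<open>2\<close>: a single nonzero one yields a string, two of them yield a cross.
\<close>

section \<open>The eigenvalue equation in terms of coordinate averages\<close>

definition coord_avg :: "'a set \<Rightarrow> nat \<Rightarrow> ((nat \<Rightarrow> 'a) \<Rightarrow> real) \<Rightarrow> (nat \<Rightarrow> 'a) \<Rightarrow> real" where
  "coord_avg S i f x = (\<Sum>a\<in>S. f (x(i := a))) / real (card S)"

text \<open>This is the operator \<open>D\<^sub>i\<close> of the overview. It acts on functions of
  arbitrary tuples, so that idempotence and commutation become equalities of functions, with no
  condition on the tuple.\<close>

definition coord_dev :: "'a set \<Rightarrow> nat \<Rightarrow> ((nat \<Rightarrow> 'a) \<Rightarrow> real) \<Rightarrow> (nat \<Rightarrow> 'a) \<Rightarrow> real" where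
  "coord_dev S i f x = f x - coord_avg S i f x"

lemma finite_hamming_verts: "finite S \<Longrightarrow> finite (hamming_verts n S)"
  by (simp add: hamming_verts_def finite_PiE)

lemma hamming_verts_upd:
  "x \<in> hamming_verts n S \<Longrightarrow> i \<in> {1..n} \<Longrightarrow> a \<in> S \<Longrightarrow> x(i := a) \<in> hamming_verts n S"
  by (auto simp: hamming_verts_def PiE_iff extensional_def)

lemma hamming_verts_nth: "x \<in> hamming_verts n S \<Longrightarrow> i \<in> {1..n} \<Longrightarrow> x i \<in> S"
  by (auto simp: hamming_verts_def)

text \<open>A neighbour is given by the coordinate that changes and its new value; excluding the old
  value \<open>x i\<close> makes this parametrisation injective.\<close>

lemma hamming_neighbours:
  assumes "x \<in> hamming_verts n S"
  shows "{y \<in> hamming_verts n S. hamming_adj n x y} =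
    (\<lambda>(i, a). x(i := a)) ` (SIGMA i:{1..n}. S - {x i})"
proof (intro equalityI subsetI)
  fix y assume y: "y \<in> {y \<in> hamming_verts n S. hamming_adj n x y}"
  then have "card {k \<in> {1..n}. x k \<noteq> y k} = 1" by (simp only: mem_Collect_eq hamming_adj_def)
  then obtain i where i: "{k \<in> {1..n}. x k \<noteq> y k} = {i}" by (rule card_1_singletonE)
  then have "i \<in> {1..n}" "x i \<noteq> y i" by blast+
  moreover have "y = x(i := y i)"
  proof
    fix k show "y k = (x(i := y i)) k"
    proof (cases "k \<in> {1..n}")
      case True
      then have "k = i \<or> x k = y k" using i by blast
      then show ?thesis by auto
    next
      case False
      then have "x k = y k"
        using assms y by (auto simp: hamming_verts_def PiE_iff extensional_def)
      then show ?thesis by simp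
    qed
  qed
  moreover have "y i \<in> S" using y \<open>i \<in> {1..n}\<close> hamming_verts_nth[of y n S i] by simp
  ultimately show "y \<in> (\<lambda>(i, a). x(i := a)) ` (SIGMA i:{1..n}. S - {x i})"
    by (intro image_eqI[where x = "(i, y i)"]) auto
next
  fix y assume "y \<in> (\<lambda>(i, a). x(i := a)) ` (SIGMA i:{1..n}. S - {x i})"
  then obtain u where "u \<in> (SIGMA i:{1..n}. S - {x i})" "y = (\<lambda>(i, a). x(i := a)) u" by blast
  then have ia: "fst u \<in> {1..n}" "snd u \<in> S" "snd u \<noteq> x (fst u)" "y = x(fst u := snd u)"
    by (cases u, simp)+
  then have "{k \<in> {1..n}. x k \<noteq> y k} = {fst u}" by auto
  then show "y \<in> {y \<in> hamming_verts n S. hamming_adj n x y}"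
    using ia hamming_verts_upd[OF assms] by (simp add: hamming_adj_def)
qed

text \<open>Summing over all of \<open>S\<close> in each coordinate also visits \<open>x\<close>
  itself, once per coordinate; the last term takes these \<open>n\<close> copies of
  \<open>f x\<close> back.\<close>

lemma adjacency_sum:
  assumes "finite S" "x \<in> hamming_verts n S"
  shows "(\<Sum>y\<in>hamming_verts n S. adjacency_matrix (hamming_adj n) x y * f y) =
    (\<Sum>i\<in>{1..n}. \<Sum>a\<in>S. f (x(i := a))) - real n * f x"
proof -
  have inj: "inj_on (\<lambda>(i, a). x(i := a)) (SIGMA i:{1..n}. S - {x i})"
  proof -
    have inj': "i = j \<and> a = b" if "x(i := a) = x(j := b)" "a \<noteq> x i" for i a j b
      using that by (metis fun_upd_other fun_upd_same)
    show ?thesis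
    proof (rule inj_onI)
      fix u v
      assume "u \<in> (SIGMA i:{1..n}. S - {x i})"
        and eq: "(case u of (i, a) \<Rightarrow> x(i := a)) = (case v of (i, a) \<Rightarrow> x(i := a))"
      then have "snd u \<noteq> x (fst u)" by (metis DiffE SigmaE fst_conv insertI1 snd_conv)
      moreover have "x(fst u := snd u) = x(fst v := snd v)"
        using eq by (simp only: case_prod_beta)
      ultimately show "u = v" using inj' by (simp add: prod_eq_iff)
    qed
  qed
  have "(\<Sum>y\<in>hamming_verts n S. adjacency_matrix (hamming_adj n) x y * f y) =
      (\<Sum>y\<in>hamming_verts n S. if hamming_adj n x y then f y else 0)"
    by (intro sum.cong) (auto simp: adjacency_matrix_def)
  also have "\<dots> = (\<Sum>y\<in>{y \<in> hamming_verts n S. hamming_adj n x y}. f y)"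
    using assms(1) by (simp add: sum.inter_filter finite_hamming_verts)
  also have "\<dots> = (\<Sum>(i, a)\<in>(SIGMA i:{1..n}. S - {x i}). f (x(i := a)))"
    unfolding hamming_neighbours[OF assms(2)] sum.reindex[OF inj]
    by (intro sum.cong) auto
  also have "\<dots> = (\<Sum>i\<in>{1..n}. \<Sum>a\<in>S - {x i}. f (x(i := a)))"
    using assms(1) by (subst sum.Sigma) auto
  also have "\<dots> = (\<Sum>i\<in>{1..n}. (\<Sum>a\<in>S. f (x(i := a))) - f x)"
    using assms(1) hamming_verts_nth[OF assms(2)] by (intro sum.cong refl) (simp add: sum_diff1)
  also have "\<dots> = (\<Sum>i\<in>{1..n}. \<Sum>a\<in>S. f (x(i := a))) - real n * f x"
    by (simp add: sum_subtractf)
  finally show ?thesis .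
qed

text \<open>The zero function satisfies the equation too, so both cases of the definition amount to
  one pointwise equation. The constant arises as
  \<open>\<lambda>\<^sub>1 + n = (q - 1) n - q + n = q (n - 1)\<close>.\<close>

lemma eigenfunction_iff_coord_sums:
  assumes "finite S" "card S = q"
  shows "is_eigenfunction (hamming_verts n S) (hamming_adj n) (hamming_eigenvalue1 n q) f \<longleftrightarrow>
    (\<forall>x\<in>hamming_verts n S.
      (\<Sum>i\<in>{1..n}. \<Sum>a\<in>S. f (x(i := a))) = real q * (real n - 1) * f x)"
proof -
  have "is_eigenfunction (hamming_verts n S) (hamming_adj n) (hamming_eigenvalue1 n q) f \<longleftrightarrow>
    (\<forall>x\<in>hamming_verts n S. (\<Sum>y\<in>hamming_verts n S.
       adjacency_matrix (hamming_adj n) x y * f y) = hamming_eigenvalue1 n q * f x)"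
  proof (cases "\<forall>x\<in>hamming_verts n S. f x = 0")
    case True
    then show ?thesis by (simp add: is_eigenfunction_def)
  next
    case False
    then have "\<exists>x\<in>hamming_verts n S. f x \<noteq> 0" by blast
    with False show ?thesis by (simp only: is_eigenfunction_def is_eigenvector_def) simp
  qed
  also have "\<dots> \<longleftrightarrow> (\<forall>x\<in>hamming_verts n S.
      (\<Sum>i\<in>{1..n}. \<Sum>a\<in>S. f (x(i := a))) = real q * (real n - 1) * f x)"
  proof (intro ball_cong refl)
    fix x assume "x \<in> hamming_verts n S"
    note sum = adjacency_sum[OF assms(1) this, of f]
    have "hamming_eigenvalue1 n q * f x = real q * (real n - 1) * f x - real n * f x"
      by (simp add: hamming_eigenvalue1_def algebra_simps)
    with sum show "((\<Sum>y\<in>hamming_verts n S. adjacency_matrix (hamming_adj n) x y * f y) =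
        hamming_eigenvalue1 n q * f x) \<longleftrightarrow>
        ((\<Sum>i\<in>{1..n}. \<Sum>a\<in>S. f (x(i := a))) = real q * (real n - 1) * f x)"
      by auto
  qed
  finally show ?thesis .
qed

text \<open>After division by \<open>q\<close> the averages add up to \<open>(n - 1) f\<close>, so
  the deviations add up to \<open>n f - (n - 1) f = f\<close>.\<close>

lemma eigenfunction_iff_coord_dev:
  assumes "finite S" "card S = q" "q > 0"
  shows "is_eigenfunction (hamming_verts n S) (hamming_adj n) (hamming_eigenvalue1 n q) f \<longleftrightarrow>
    (\<forall>x\<in>hamming_verts n S. (\<Sum>i\<in>{1..n}. coord_dev S i f x) = f x)"
  unfolding eigenfunction_iff_coord_sums[OF assms(1,2)]
proof (intro ball_cong refl)
  fix x
  let ?s = "\<Sum>i\<in>{1..n}. \<Sum>a\<in>S. f (x(i := a))"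
  have "(\<Sum>i\<in>{1..n}. coord_dev S i f x) = real n * f x - ?s / real q"
    using assms(2) by (simp add: coord_dev_def coord_avg_def sum_subtractf sum_divide_distrib)
  moreover have "?s = real q * (real n - 1) * f x \<longleftrightarrow> ?s / real q = (real n - 1) * f x"
    using assms(3) by (simp add: nonzero_divide_eq_eq mult_ac)
  ultimately show "?s = real q * (real n - 1) * f x \<longleftrightarrow>
      (\<Sum>i\<in>{1..n}. coord_dev S i f x) = f x"
    by (auto simp: left_diff_distrib)
qed

text \<open>Changing the \<open>i\<close>-th entry to \<open>a\<close> adds
  \<open>g i a - g i (x i)\<close> to \<open>f\<close>. Summed over \<open>a\<close> and
  \<open>i\<close>, the first terms cancel by hypothesis and the second ones give
  \<open>- q f x\<close>. The zero-sum condition concerns the total so as to fit crosses, whose two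
  summands have sums \<open>card A\<close> and \<open>- card B\<close>.\<close>

lemma eigenfunction_of_coord_decomposition:
  assumes "finite S" "card S = q"
    and f: "\<And>x. x \<in> hamming_verts n S \<Longrightarrow> f x = (\<Sum>i\<in>{1..n}. g i (x i))"
    and g: "(\<Sum>i\<in>{1..n}. \<Sum>a\<in>S. g i a) = 0"
  shows "is_eigenfunction (hamming_verts n S) (hamming_adj n) (hamming_eigenvalue1 n q) f"
  unfolding eigenfunction_iff_coord_sums[OF assms(1,2)]
proof
  fix x assume x: "x \<in> hamming_verts n S"
  have "f (x(i := a)) = f x - g i (x i) + g i a" if "i \<in> {1..n}" "a \<in> S" for i a
  proof -
    have "f (x(i := a)) = g i a + (\<Sum>k\<in>{1..n} - {i}. g k (x k))"
      using that x by (simp add: f hamming_verts_upd sum.remove[of _ i])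
    moreover have "f x = g i (x i) + (\<Sum>k\<in>{1..n} - {i}. g k (x k))"
      using that x by (simp add: f sum.remove[of _ i])
    ultimately show ?thesis by simp
  qed
  then have "(\<Sum>i\<in>{1..n}. \<Sum>a\<in>S. f (x(i := a))) =
      (\<Sum>i\<in>{1..n}. \<Sum>a\<in>S. f x - g i (x i) + g i a)"
    by (intro sum.cong refl) blast
  also have "\<dots> = real q * (real n * f x - (\<Sum>i\<in>{1..n}. g i (x i)))"
    using assms by (simp add: sum.distrib sum_subtractf sum_distrib_left right_diff_distrib)
  also have "\<dots> = real q * (real n - 1) * f x"
    using f[OF x] by (simp add: algebra_simps)
  finally show "(\<Sum>i\<in>{1..n}. \<Sum>a\<in>S. f (x(i := a))) = real q * (real n - 1) * f x" .
qed

section \<open>Projection properties of the averaging and deviation operators\<close>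

lemma coord_avg_avg:
  assumes "finite S" "S \<noteq> {}"
  shows "coord_avg S i (coord_avg S i f) = coord_avg S i f"
  using assms by (auto simp: coord_avg_def fun_eq_iff)

lemma coord_avg_commute:
  "coord_avg S i (coord_avg S j f) = coord_avg S j (coord_avg S i f)"
proof (cases "i = j")
  case False
  show ?thesis
  proof
    fix x
    show "coord_avg S i (coord_avg S j f) x = coord_avg S j (coord_avg S i f) x"
      using False
      by (simp add: coord_avg_def sum_divide_distrib[symmetric] fun_upd_twist[of i j])
         (subst sum.swap, simp)
  qed
qed simp

lemma coord_avg_diff:
  "coord_avg S i (\<lambda>x. f x - g x) = (\<lambda>x. coord_avg S i f x - coord_avg S i g x)"
  by (simp add: coord_avg_def sum_subtractf diff_divide_distrib fun_eq_iff)

lemma coord_dev_altdef: "coord_dev S i f = (\<lambda>x. f x - coord_avg S i f x)"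
  by (simp add: coord_dev_def fun_eq_iff)

lemma coord_avg_dev:
  "finite S \<Longrightarrow> S \<noteq> {} \<Longrightarrow> coord_avg S i (coord_dev S i f) x = 0"
  by (simp add: coord_dev_altdef coord_avg_diff coord_avg_avg)

lemma coord_dev_dev:
  "finite S \<Longrightarrow> S \<noteq> {} \<Longrightarrow> coord_dev S i (coord_dev S i f) = coord_dev S i f"
  by (simp add: coord_dev_def coord_avg_dev fun_eq_iff)

lemma coord_dev_commute:
  "coord_dev S i (coord_dev S j f) = coord_dev S j (coord_dev S i f)"
  by (simp add: coord_dev_altdef coord_avg_diff coord_avg_commute[of S i j] fun_eq_iff)

lemma coord_dev_sum:
  "coord_dev S i (\<lambda>x. \<Sum>j\<in>J. h j x) x = (\<Sum>j\<in>J. coord_dev S i (h j) x)"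
  unfolding coord_dev_def coord_avg_def
  by (subst sum.swap) (simp add: sum_subtractf sum_divide_distrib)

text \<open>Averaging over a coordinate of a vertex visits vertices only. This allows the operators
  to be applied to the eigenvalue equation, which is known on the vertex set alone.\<close>

lemma coord_dev_cong:
  assumes "\<And>x. x \<in> hamming_verts n S \<Longrightarrow> f x = g x" "i \<in> {1..n}" "x \<in> hamming_verts n S"
  shows "coord_dev S i f x = coord_dev S i g x"
  using assms by (simp add: coord_dev_def coord_avg_def hamming_verts_upd cong: sum.cong)

text \<open>Both sides are sums over pairs of a vertex and a letter, and the involution that swaps
  the letter with the \<open>i\<close>-th entry carries one into the other.\<close>

lemma coord_avg_self_adjoint:
  assumes "finite S" "i \<in> {1..n}"
  shows "(\<Sum>x\<in>hamming_verts n S. coord_avg S i f x * g x) =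
    (\<Sum>x\<in>hamming_verts n S. f x * coord_avg S i g x)"
proof -
  let ?V = "hamming_verts n S"
  have "(\<Sum>(x, a)\<in>?V \<times> S. f (x(i := a)) * g x) = (\<Sum>(x, a)\<in>?V \<times> S. f x * g (x(i := a)))"
    using assms
    by (intro sum.reindex_bij_witness[where i = "\<lambda>(x, a). (x(i := a), x i)"
          and j = "\<lambda>(x, a). (x(i := a), x i)"])
      (auto simp: hamming_verts_upd hamming_verts_nth)
  then show ?thesis
    by (simp add: coord_avg_def sum.cartesian_product[symmetric] sum_distrib_left
        sum_distrib_right sum_divide_distrib[symmetric])
qed

lemma coord_dev_self_adjoint:
  assumes "finite S" "i \<in> {1..n}"
  shows "(\<Sum>x\<in>hamming_verts n S. coord_dev S i f x * g x) =
    (\<Sum>x\<in>hamming_verts n S. f x * coord_dev S i g x)"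
  using coord_avg_self_adjoint[OF assms, of f g]
  by (simp add: coord_dev_def left_diff_distrib right_diff_distrib sum_subtractf)

text \<open>The product \<open>P\<close> of two commuting self-adjoint projections is again one, so
  \<open><P f, f> = <P P f, f> = <P f, P f>\<close>.\<close>

lemma coord_dev_dev_inner:
  assumes "finite S" "S \<noteq> {}" "i \<in> {1..n}" "j \<in> {1..n}"
  shows "(\<Sum>x\<in>hamming_verts n S. coord_dev S j (coord_dev S i f) x * f x) =
    (\<Sum>x\<in>hamming_verts n S. (coord_dev S j (coord_dev S i f) x)\<^sup>2)"
proof -
  let ?V = "hamming_verts n S" and ?h = "coord_dev S j (coord_dev S i f)"
  have "?h = coord_dev S j (coord_dev S i ?h)"
    by (simp only: coord_dev_commute[of S i j] coord_dev_dev[OF assms(1,2)])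
  then have "(\<Sum>x\<in>?V. ?h x * f x) = (\<Sum>x\<in>?V. coord_dev S j (coord_dev S i ?h) x * f x)"
    by simp
  also have "\<dots> = (\<Sum>x\<in>?V. ?h x * coord_dev S i (coord_dev S j f) x)"
    using assms by (simp only: coord_dev_self_adjoint)
  finally show ?thesis
    by (simp add: power2_eq_square coord_dev_commute[of S i j])
qed

section \<open>Eigenfunctions as sums of functions of one coordinate\<close>

lemma coord_dev_dev_eq_0:
  assumes S: "finite S" "S \<noteq> {}"
    and eq: "\<And>x. x \<in> hamming_verts n S \<Longrightarrow> (\<Sum>i\<in>{1..n}. coord_dev S i f x) = f x"
    and ij: "i \<in> {1..n}" "j \<in> {1..n}" "i \<noteq> j" and x: "x \<in> hamming_verts n S"
  shows "coord_dev S j (coord_dev S i f) x = 0"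
proof -
  let ?V = "hamming_verts n S" and ?h = "\<lambda>k. coord_dev S k (coord_dev S i f)"
  \<comment> \<open>By idempotence the term \<open>k = i\<close> of the transformed equation is
    \<open>D\<^sub>i f\<close> itself and cancels against the other side.\<close>
  have rest: "(\<Sum>k\<in>{1..n} - {i}. ?h k y) = 0" if "y \<in> ?V" for y
  proof -
    have "coord_dev S i f y = coord_dev S i (\<lambda>x. \<Sum>k\<in>{1..n}. coord_dev S k f x) y"
      using eq by (intro coord_dev_cong[OF _ ij(1) that]) simp
    also have "\<dots> = (\<Sum>k\<in>{1..n}. ?h k y)"
      by (simp add: coord_dev_sum coord_dev_commute[of S i])
    also have "\<dots> = coord_dev S i f y + (\<Sum>k\<in>{1..n} - {i}. ?h k y)"
      using ij S by (simp add: sum.remove[of _ i] coord_dev_dev)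
    finally show ?thesis by simp
  qed
  have "(\<Sum>k\<in>{1..n} - {i}. \<Sum>y\<in>?V. (?h k y)\<^sup>2) = (\<Sum>k\<in>{1..n} - {i}. \<Sum>y\<in>?V. ?h k y * f y)"
    using ij S by (intro sum.cong refl coord_dev_dev_inner[symmetric]) auto
  also have "\<dots> = (\<Sum>y\<in>?V. (\<Sum>k\<in>{1..n} - {i}. ?h k y) * f y)"
    by (subst sum.swap) (simp add: sum_distrib_right)
  also have "\<dots> = 0" using rest by simp
  \<comment> \<open>A zero sum of nonnegative terms forces each to vanish: here the squared norm for
    \<open>k = j\<close>, below its summand at every vertex.\<close>
  finally have "(\<Sum>y\<in>?V. (?h j y)\<^sup>2) = 0"
    using ij by (subst (asm) sum_nonneg_eq_0_iff) (auto intro: sum_nonneg)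
  then show ?thesis
    using x S by (subst (asm) sum_nonneg_eq_0_iff) (auto simp: finite_hamming_verts)
qed

text \<open>Here \<open>h\<close> equals its own average over the \<open>j\<close>-th coordinate,
  and that average does not see the \<open>j\<close>-th entry.\<close>

lemma coord_dev_eq_0_imp_upd:
  assumes "\<And>x. x \<in> hamming_verts n S \<Longrightarrow> coord_dev S j h x = 0"
    and "x \<in> hamming_verts n S" "j \<in> {1..n}" "a \<in> S"
  shows "h (x(j := a)) = h x"
proof -
  have "h (x(j := a)) = coord_avg S j h (x(j := a))" "h x = coord_avg S j h x"
    using assms hamming_verts_upd[OF assms(2-4)] by (simp_all add: coord_dev_def)
  then show ?thesis by (simp add: coord_avg_def)
qed

text \<open>Walk from \<open>x\<close> to \<open>y\<close> one coordinate at a time, never touching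
  \<open>i\<close>. The induction also carries vertex membership, since \<open>upd\<close> speaks
  about vertices only.\<close>

lemma depends_on_single_coord:
  assumes upd: "\<And>x j a. x \<in> hamming_verts n S \<Longrightarrow> j \<in> {1..n} \<Longrightarrow> j \<noteq> i \<Longrightarrow> a \<in> S \<Longrightarrow>
      h (x(j := a)) = h x"
    and x: "x \<in> hamming_verts n S" and y: "y \<in> hamming_verts n S" and "x i = y i"
  shows "h x = h y"
proof -
  have "override_on x y J \<in> hamming_verts n S \<and> h (override_on x y J) = h x"
    if "finite J" "J \<subseteq> {1..n} - {i}" for J
    using that
  proof (induction J)
    case empty
    then show ?case using x by simp
  next
    case (insert j J)
    then have j: "j \<in> {1..n}" "j \<noteq> i" "y j \<in> S" using hamming_verts_nth[OF y, of j] by auto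
    have "override_on x y (insert j J) = (override_on x y J)(j := y j)"
      by (auto simp: override_on_def fun_eq_iff)
    moreover have "override_on x y J \<in> hamming_verts n S" "h (override_on x y J) = h x"
      using insert by auto
    ultimately show ?case using upd[of "override_on x y J" j "y j"] j
      by (metis hamming_verts_upd)
  qed
  from this[of "{1..n} - {i}"] have "h (override_on x y ({1..n} - {i})) = h x" by simp
  moreover have "override_on x y ({1..n} - {i}) = y"
  proof
    fix k
    \<comment> \<open>Outside the index set both extensional tuples take the same default
      value.\<close>
    have "x k = y k" if "k \<notin> {1..n}"
      using that x y by (auto simp: hamming_verts_def PiE_iff extensional_def)
    then show "override_on x y ({1..n} - {i}) k = y k"
      using \<open>x i = y i\<close> by (auto simp: override_on_def)
  qed
  ultimately show ?thesis by simp
qed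

lemma eigenfunction_coord_decomposition:
  assumes S: "finite S" "S \<noteq> {}"
    and "is_eigenfunction (hamming_verts n S) (hamming_adj n) (hamming_eigenvalue1 n (card S)) f"
  obtains g where "\<And>x. x \<in> hamming_verts n S \<Longrightarrow> f x = (\<Sum>i\<in>{1..n}. g i (x i))"
    and "\<And>i. i \<in> {1..n} \<Longrightarrow> (\<Sum>a\<in>S. g i a) = 0"
proof -
  let ?V = "hamming_verts n S"
  have "card S > 0" using S by (simp add: card_gt_0_iff)
  then have eq: "(\<Sum>i\<in>{1..n}. coord_dev S i f x) = f x" if "x \<in> ?V" for x
    using assms that by (simp add: eigenfunction_iff_coord_dev)
  obtain s where "s \<in> S" using S by blast
  \<comment> \<open>An arbitrary base vertex: \<open>D\<^sub>i f\<close> will turn out to depend on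
    the \<open>i\<close>-th entry alone, so its values can be read off by varying that entry of
    \<open>z\<close>.\<close>
  define z where "z = (\<lambda>i\<in>{1..n}. s)"
  have z: "z \<in> ?V" using \<open>s \<in> S\<close> by (auto simp: z_def hamming_verts_def)
  define g where "g i a = coord_dev S i f (z(i := a))" for i a
  have dev: "coord_dev S i f x = g i (x i)" if "x \<in> ?V" "i \<in> {1..n}" for x i
    unfolding g_def
  proof (rule depends_on_single_coord[of n S i])
    fix x j a assume "x \<in> ?V" "j \<in> {1..n}" "j \<noteq> i" "a \<in> S"
    then show "coord_dev S i f (x(j := a)) = coord_dev S i f x"
      using coord_dev_dev_eq_0[OF S eq] that by (intro coord_dev_eq_0_imp_upd) auto
  next
    show "z(i := x i) \<in> ?V"
      using hamming_verts_upd[OF z that(2) hamming_verts_nth[OF that]] .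
  qed (use that in auto)
  show ?thesis
  proof
    show "f x = (\<Sum>i\<in>{1..n}. g i (x i))" if "x \<in> ?V" for x
      using eq[OF that] dev[OF that] by simp
    show "(\<Sum>a\<in>S. g i a) = 0" for i
      using coord_avg_dev[OF S, of i f z] S by (auto simp: g_def coord_avg_def)
  qed
qed

section \<open>Classification of the sums with values 0, -1, 1\<close>

lemma sum_indicator_diff:
  assumes "finite S" "A \<subseteq> S" "B \<subseteq> S"
  shows "(\<Sum>a\<in>S. (of_bool (a \<in> A) - of_bool (a \<in> B) :: real)) = real (card A) - real (card B)"
proof -
  have "S \<inter> A = A" "S \<inter> B = B" using assms by auto
  then show ?thesis using assms(1) by (simp add: sum_subtractf)
qed

text \<open>The level sets of \<open>g\<close> at 1 and -1 serve as \<open>A\<close> and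
  \<open>B\<close>; the zero sum says that they are equally large, and \<open>s\<close> lies in one
  of them.\<close>

lemma single_coord_is_string:
  assumes "finite S" "i \<in> {1..n}"
    and f: "\<And>x. x \<in> hamming_verts n S \<Longrightarrow> f x = g (x i)"
    and g: "\<And>a. a \<in> S \<Longrightarrow> g a \<in> {0, -1, 1 :: real}" "(\<Sum>a\<in>S. g a) = 0"
    and "s \<in> S" "g s \<noteq> 0"
  shows "is_string n S f"
proof -
  define A B where "A = {a \<in> S. g a = 1}" and "B = {a \<in> S. g a = -1}"
  have AB: "A \<subseteq> S" "B \<subseteq> S" "A \<inter> B = {}" "A \<union> B \<noteq> {}"
    using assms by (auto simp: A_def B_def)
  have "(\<Sum>a\<in>S. g a) = (\<Sum>a\<in>S. of_bool (a \<in> A) - of_bool (a \<in> B))"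
    using g by (intro sum.cong) (auto simp: A_def B_def)
  then have "card A = card B" using AB assms by (simp add: sum_indicator_diff)
  moreover have "f x = string_fun A B i x" if "x \<in> hamming_verts n S" for x
    using f[OF that] g(1)[of "x i"] hamming_verts_nth[OF that assms(2)]
    by (auto simp: string_fun_def A_def B_def)
  ultimately show ?thesis unfolding is_string_def using AB assms(2) by blast
qed

text \<open>The offsets \<open>m\<close> and \<open>- m\<close> cancel, so the value is the
  indicator of \<open>x i \<in> A\<close> minus that of \<open>x j \<in> B\<close>, which is exactly
  a cross.\<close>

lemma two_coords_is_cross:
  assumes "finite S" "i \<in> {1..n}" "j \<in> {1..n}" "i \<noteq> j"
    and f: "\<And>x. x \<in> hamming_verts n S \<Longrightarrow> f x = g (x i) + h (x j)"
    and g: "\<And>a. a \<in> S \<Longrightarrow> g a = m \<or> g a = m + 1" "(\<Sum>a\<in>S. g a) = 0"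
    and h: "\<And>a. a \<in> S \<Longrightarrow> h a = - m \<or> h a = - m - (1 :: real)" "(\<Sum>a\<in>S. h a) = 0"
    and s: "s \<in> S" "g s = m + 1"
  shows "is_cross n S f"
proof -
  define A B where "A = {a \<in> S. g a = m + 1}" and "B = {a \<in> S. h a = - m - 1}"
  have AB: "A \<subseteq> S" "B \<subseteq> S" "A \<noteq> {}" using s by (auto simp: A_def B_def)
  \<comment> \<open>Both functions are evaluated at the same letter so that a single sum over
    \<open>S\<close>, free of \<open>m\<close>, compares the cardinalities.\<close>
  have "g a + h a = of_bool (a \<in> A) - of_bool (a \<in> B)" if "a \<in> S" for a
    using g(1)[OF that] h(1)[OF that] that by (auto simp: A_def B_def)
  then have "(\<Sum>a\<in>S. g a + h a) = (\<Sum>a\<in>S. of_bool (a \<in> A) - of_bool (a \<in> B))"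
    by (intro sum.cong) auto
  then have card: "card A = card B"
    using AB g(2) h(2) \<open>finite S\<close> by (simp add: sum_indicator_diff sum.distrib)
  moreover have "B \<noteq> {}"
    using card AB \<open>finite S\<close> by (metis card_0_eq card.empty finite_subset)
  moreover have "f x = cross_fun A B i j x" if "x \<in> hamming_verts n S" for x
    using f[OF that] g(1)[of "x i"] h(1)[of "x j"] hamming_verts_nth[OF that] assms(2,3)
    by (auto simp: cross_fun_def A_def B_def)
  ultimately show ?thesis unfolding is_cross_def using AB assms(2-4) by blast
qed

lemma ternary_coord_decomposition_cases:
  assumes S: "finite S" "S \<noteq> {}"
    and ran: "f \<in> hamming_verts n S \<rightarrow> {0, -1, 1}"
    and f: "\<And>x. x \<in> hamming_verts n S \<Longrightarrow> f x = (\<Sum>i\<in>{1..n}. g i (x i))"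
    and g0: "\<And>i. i \<in> {1..n} \<Longrightarrow> (\<Sum>a\<in>S. g i a) = 0"
  shows "is_cross n S f \<or> is_string n S f \<or> (\<forall>x\<in>hamming_verts n S. f x = 0)"
proof -
  let ?V = "hamming_verts n S"
  have "\<exists>a\<in>S. \<forall>b\<in>S. g i b \<le> g i a" for i
    using S Max_in[of "g i ` S"] Max_ge[of "g i ` S"] by fastforce
  then obtain p0 where p0: "\<And>i. p0 i \<in> S" "\<And>i b. b \<in> S \<Longrightarrow> g i b \<le> g i (p0 i)" by metis
  have "\<exists>a\<in>S. \<forall>b\<in>S. g i a \<le> g i b" for i
    using S Min_in[of "g i ` S"] Min_le[of "g i ` S"] by fastforce
  then obtain m0 where m0: "\<And>i. m0 i \<in> S" "\<And>i b. b \<in> S \<Longrightarrow> g i (m0 i) \<le> g i b" by metis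
  \<comment> \<open>These vertices maximise and minimise every \<open>g i\<close> at once, hence
    also \<open>f\<close>.\<close>
  define p m where "p = restrict p0 {1..n}" and "m = restrict m0 {1..n}"
  have V: "p \<in> ?V" "m \<in> ?V" using p0 m0 by (auto simp: p_def m_def hamming_verts_def)
  have ran': "f x \<in> {0, -1, 1}" if "x \<in> ?V" for x using ran that by blast
  define r where "r i = g i (p i) - g i (m i)" for i
  have bnd: "g i (m i) \<le> g i a" "g i a \<le> g i (m i) + r i" if "i \<in> {1..n}" "a \<in> S" for i a
    using p0 m0 that by (simp_all add: r_def p_def m_def)
  have upd: "f (m(i := a)) = f m + (g i a - g i (m i))" if "i \<in> {1..n}" "a \<in> S" for i a
    using that V by (simp add: f hamming_verts_upd sum.remove[of _ i])
  have r_nonneg: "r i \<ge> 0" if "i \<in> {1..n}" for i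
    using bnd[OF that m0(1)[of i]] by simp
  \<comment> \<open>By \<open>upd\<close> this is a difference of two values of \<open>f\<close>,
    and it is nonnegative because \<open>m\<close> minimises \<open>g i\<close>.\<close>
  have Ints: "g i a - g i (m i) \<in> {0, 1, 2}" if "i \<in> {1..n}" "a \<in> S" for i a
    using upd[OF that] ran'[OF V(2)] ran'[OF hamming_verts_upd[OF V(2) that]] bnd[OF that]
    by auto
  have r_ge_1: "r i \<ge> 1" if "i \<in> {1..n}" "r i \<noteq> 0" for i
    using Ints[OF that(1), of "p i"] that p0(1)[of i] by (auto simp: r_def p_def)
  \<comment> \<open>The total oscillation is a single difference of values of \<open>f\<close>,
    hence at most \<open>1 - (-1) = 2\<close>.\<close>
  have r_sum: "f p - f m = (\<Sum>i\<in>{1..n}. r i)"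
    using V by (simp add: f r_def sum_subtractf)
  then have r_sum_le: "(\<Sum>i\<in>{1..n}. r i) \<le> 2"
    using ran'[OF V(1)] ran'[OF V(2)] by auto
  \<comment> \<open>Without oscillation \<open>g i\<close> is constant, and its zero sum makes the
    constant zero.\<close>
  have g_zero: "g i a = 0" if "i \<in> {1..n}" "r i = 0" "a \<in> S" for i a
  proof -
    have "g i b = g i a" if "b \<in> S" for b
      using bnd[of i a] bnd[of i b] that \<open>i \<in> {1..n}\<close> \<open>r i = 0\<close> \<open>a \<in> S\<close> by simp
    then have "(\<Sum>b\<in>S. g i b) = real (card S) * g i a" by simp
    then show ?thesis using g0[OF that(1)] S by simp
  qed
  consider "\<And>i. i \<in> {1..n} \<Longrightarrow> r i = 0"
    | i where "i \<in> {1..n}" "r i \<noteq> 0" "\<And>j. j \<in> {1..n} \<Longrightarrow> j \<noteq> i \<Longrightarrow> r j = 0"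
    | i j where "i \<in> {1..n}" "r i \<noteq> 0" "j \<in> {1..n}" "r j \<noteq> 0" "i \<noteq> j"
    by metis
  then show ?thesis
  proof cases
    case 1
    have "f x = 0" if "x \<in> ?V" for x
      unfolding f[OF that] using 1 g_zero hamming_verts_nth[OF that] by (intro sum.neutral) auto
    then show ?thesis by blast
  next
    case 2
    have fi: "f x = g i (x i)" if "x \<in> ?V" for x
    proof -
      have "(\<Sum>k\<in>{1..n} - {i}. g k (x k)) = 0"
        using 2 g_zero hamming_verts_nth[OF that] by (intro sum.neutral) auto
      then show ?thesis using f[OF that] 2(1) by (simp add: sum.remove[of _ i])
    qed
    \<comment> \<open>Every letter occurs as the \<open>i\<close>-th entry of some vertex, here
      \<open>m(i := a)\<close>.\<close>
    have "g i a \<in> {0, -1, 1}" if "a \<in> S" for a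
      using fi ran' hamming_verts_upd[OF V(2) 2(1) that] by (metis fun_upd_same)
    moreover have "g i (p i) \<noteq> 0 \<or> g i (m i) \<noteq> 0" using 2(2) by (auto simp: r_def)
    ultimately have "is_string n S f"
      using S 2(1) fi g0 hamming_verts_nth[OF V(1) 2(1)] hamming_verts_nth[OF V(2) 2(1)]
        single_coord_is_string[of S i n f "g i"] by blast
    then show ?thesis by blast
  next
    case 3
    have split: "(\<Sum>k\<in>{1..n}. u k) = u i + u j + (\<Sum>k\<in>{1..n} - {i} - {j}. u k)"
      for u :: "nat \<Rightarrow> real"
      using 3 by (simp add: sum.remove[of _ i] sum.remove[of _ j])
    have nonneg: "(\<Sum>k\<in>{1..n} - {i} - {j}. r k) \<ge> 0"
      using r_nonneg by (intro sum_nonneg) auto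
    \<comment> \<open>Two oscillations of at least 1 exhaust the bound 2: both equal 1 and nothing
      remains for other coordinates.\<close>
    have "r i \<ge> 1" "r j \<ge> 1" using r_ge_1 3 by blast+
    then have r: "r i = 1" "r j = 1" "(\<Sum>k\<in>{1..n} - {i} - {j}. r k) = 0"
      using r_sum_le nonneg split[of r] by linarith+
    have rk: "r k = 0" if "k \<in> {1..n} - {i} - {j}" for k
      using r(3) r_nonneg that by (subst (asm) sum_nonneg_eq_0_iff) auto
    have fij: "f x = g i (x i) + g j (x j)" if "x \<in> ?V" for x
    proof -
      have "(\<Sum>k\<in>{1..n} - {i} - {j}. g k (x k)) = 0"
        using rk g_zero hamming_verts_nth[OF that] by (intro sum.neutral) auto
      then show ?thesis using f[OF that] split[of "\<lambda>k. g k (x k)"] by simp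
    qed
    \<comment> \<open>The full range is attained, so \<open>f m = -1\<close>. This ties the two
      minima together, and \<open>g i (m i)\<close> becomes the offset of the cross lemma.\<close>
    have "f p - f m = 2" using r_sum split[of r] r by simp
    then have "f m = -1" using ran'[OF V(1)] ran'[OF V(2)] by auto
    then have m: "g j (m j) = - g i (m i) - 1" using fij[OF V(2)] by simp
    have "is_cross n S f"
    proof (rule two_coords_is_cross[OF S(1) 3(1,3,5) fij])
      show "g i a = g i (m i) \<or> g i a = g i (m i) + 1" if "a \<in> S" for a
        using Ints[OF 3(1) that] bnd[OF 3(1) that] r by auto
      show "g j a = - g i (m i) \<or> g j a = - g i (m i) - 1" if "a \<in> S" for a
        using Ints[OF 3(3) that] bnd[OF 3(3) that] r m by auto
      show "p i \<in> S" using hamming_verts_nth[OF V(1) 3(1)] .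
      show "g i (p i) = g i (m i) + 1" using r(1) by (simp add: r_def)
    qed (use g0 3 in auto)
    then show ?thesis by blast
  qed
qed

section \<open>Strings and crosses are eigenfunctions\<close>

lemma string_is_eigenfunction:
  assumes "finite S" "card S = q" "is_string n S f"
  shows "is_eigenfunction (hamming_verts n S) (hamming_adj n) (hamming_eigenvalue1 n q) f"
proof -
  obtain A B i where i: "i \<in> {1..n}" and AB: "A \<subseteq> S" "B \<subseteq> S" "A \<inter> B = {}" "card A = card B"
    and f: "\<And>x. x \<in> hamming_verts n S \<Longrightarrow> f x = string_fun A B i x"
    using assms(3) unfolding is_string_def by blast
  \<comment> \<open>Disjointness of \<open>A\<close> and \<open>B\<close> makes this difference of
    indicators agree with the three-way case distinction of the string.\<close>
  define u :: "'a \<Rightarrow> real" where "u a = of_bool (a \<in> A) - of_bool (a \<in> B)" for a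
  have sum_u: "(\<Sum>a\<in>S. u a) = 0"
    using AB assms(1) unfolding u_def by (simp add: sum_indicator_diff)
  show ?thesis
  proof (rule eigenfunction_of_coord_decomposition[OF assms(1,2),
        where g = "\<lambda>k a. if k = i then u a else 0"])
    fix x assume "x \<in> hamming_verts n S"
    then show "f x = (\<Sum>k\<in>{1..n}. if k = i then u (x k) else 0)"
      using i AB f by (auto simp: string_fun_def u_def)
  next
    have "(\<Sum>a\<in>S. if k = i then u a else 0) = 0" for k
      using sum_u by (cases "k = i") simp_all
    then show "(\<Sum>k\<in>{1..n}. \<Sum>a\<in>S. if k = i then u a else 0) = 0"
      by simp
  qed
qed

lemma cross_is_eigenfunction:
  assumes "finite S" "card S = q" "is_cross n S f"
  shows "is_eigenfunction (hamming_verts n S) (hamming_adj n) (hamming_eigenvalue1 n q) f"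
proof -
  obtain A B i j where ij: "i \<in> {1..n}" "j \<in> {1..n}" "i \<noteq> j"
    and AB: "A \<subseteq> S" "B \<subseteq> S" "card A = card B"
    and f: "\<And>x. x \<in> hamming_verts n S \<Longrightarrow> f x = cross_fun A B i j x"
    using assms(3) unfolding is_cross_def by blast
  define g :: "nat \<Rightarrow> 'a \<Rightarrow> real" where
    "g k a = (if k = i then of_bool (a \<in> A) else 0) - (if k = j then of_bool (a \<in> B) else 0)" for k a
  show ?thesis
  proof (rule eigenfunction_of_coord_decomposition[OF assms(1,2), where g = g])
    fix x assume "x \<in> hamming_verts n S"
    then show "f x = (\<Sum>k\<in>{1..n}. g k (x k))"
      using ij f by (auto simp: cross_fun_def g_def sum_subtractf)
  next
    show "(\<Sum>k\<in>{1..n}. \<Sum>a\<in>S. g k a) = 0"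
    \<comment> \<open>The two coordinate sums vanish only together, so the coordinates are combined
      first, for each letter separately.\<close>
    proof (subst sum.swap)
      have "(\<Sum>k\<in>{1..n}. g k a) = of_bool (a \<in> A) - of_bool (a \<in> B)" for a
        using ij by (simp add: g_def sum_subtractf)
      then show "(\<Sum>a\<in>S. \<Sum>k\<in>{1..n}. g k a) = 0"
        using AB assms(1) by (simp add: sum_indicator_diff)
    qed
  qed
qed

theorem lemma4:
  fixes n q :: nat and S :: "'a set" and f :: "(nat \<Rightarrow> 'a) \<Rightarrow> real"
  assumes "q \<ge> 2" and "n \<ge> 1"
    and "finite S" and "card S = q"
    and "f \<in> hamming_verts n S \<rightarrow> {0, -1, 1}"
  shows "is_eigenfunction (hamming_verts n S) (hamming_adj n) (hamming_eigenvalue1 n q) f \<longleftrightarrow>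
    is_cross n S f \<or> is_string n S f \<or> (\<forall>x\<in>hamming_verts n S. f x = 0)"
proof
  assume "is_eigenfunction (hamming_verts n S) (hamming_adj n) (hamming_eigenvalue1 n q) f"
  moreover have "S \<noteq> {}" using assms by auto
  ultimately obtain g where
    "\<And>x. x \<in> hamming_verts n S \<Longrightarrow> f x = (\<Sum>i\<in>{1..n}. g i (x i))"
    "\<And>i. i \<in> {1..n} \<Longrightarrow> (\<Sum>a\<in>S. g i a) = 0"
    using assms eigenfunction_coord_decomposition[of S n f] by metis
  then show "is_cross n S f \<or> is_string n S f \<or> (\<forall>x\<in>hamming_verts n S. f x = 0)"
    using ternary_coord_decomposition_cases assms \<open>S \<noteq> {}\<close> by blast
next
  assume "is_cross n S f \<or> is_string n S f \<or> (\<forall>x\<in>hamming_verts n S. f x = 0)"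
  then show "is_eigenfunction (hamming_verts n S) (hamming_adj n) (hamming_eigenvalue1 n q) f"
    using cross_is_eigenfunction[OF assms(3,4)] string_is_eigenfunction[OF assms(3,4)]
    unfolding is_eigenfunction_def by blast
qed

end
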